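(* Let $\mathcal{G}$ be a connected, locally finite, vertex-transitive, infinite graph with a distinguished vertex $0$, let $H\le\mathrm{Aut}(\mathcal{G})$ be a subgroup, and let $X\subseteq\mathrm{Lip}_0(\mathcal{G})$ be an $H$-invariant linear subspace. Then $X$ is a pointwise closed $H$-invariant subspace of $\mathrm{Lip}_0(\mathcal{G})$ if and only if there exists a set $\mathcal{P}$ of patterns such that $X$ consists precisely of those $f\in\mathrm{Lip}_0(\mathcal{G})$ that are compatible with each $P\in\mathcal{P}$.
   Context: A graph $\mathcal{G}=(V_{\mathcal{G}},E_{\mathcal{G}})$ has vertex set $V_{\mathcal{G}}$ and a symmetric edge set $E_{\mathcal{G}}\subseteq V_{\mathcal{G}}^2$; $d$ is the graph (shortest path) metric on $V_{\mathcal{G}}$. $\mathrm{Lip}_0(\mathcal{G})$ is the Banach space of all Lipschitz functions $f:V_{\mathcal{G}}\to\mathbb{R}$ with $f(0)=0$, normed by the optimal Lipschitz constant. $\mathrm{Aut}(\mathcal{G})$ is the group of graph automorphisms. For $h\in\mathrm{Aut}(\mathcal{G})$ and $f\in\mathrm{Lip}_0(\mathcal{G})$ set $(h\cdot f)(x)=f(h^{-1}x)-f(h^{-1}0)$. A linear subspace $X\subseteq\mathrm{Lip}_0(\mathcal{G})$ is $H$-invariant if $h\cdot X=X$ for all $h\in H$. It is pointwise closed if it is closed in $\mathrm{Lip}_0(\mathcal{G})$ in the topology of pointwise convergence on $V_{\mathcal{G}}$. A pattern is a linear subspace $P$ of $\mathbb{R}^{A_P}$ for some non-empty finite set $A_P\subseteq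 V_{\mathcal{G}}$ (the support of $P$). A function $f\in\mathrm{Lip}_0(\mathcal{G})$ is compatible with $P$ if $(h\cdot f)\restriction A_P\in P$ for every $h\in H$. *)

theory Defs
  imports "HOL-Analysis.Function_Topology" "HOL-Algebra.Bij"
    "Graph_Theory.Digraph_Component" "Graph_Theory.Shortest_Path"
begin

section \<open>Graphs\<close>

text \<open>A graph is a \<^locale>\<open>pair_sym_digraph\<close>: a vertex set with a symmetric edge relation on it
  (loops are not excluded).\<close>

text \<open>Shortest-path distance with unit arc weights. It is a metric on connected graphs; for
  vertices in different components \<^const>\<open>real_of_ereal\<close> would turn \<open>\<infinity>\<close> into \<open>0\<close>.\<close>

definition graph_dist :: "'v pair_pre_digraph \<Rightarrow> 'v \<Rightarrow> 'v \<Rightarrow> real" where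
  "graph_dist G x y = real_of_ereal (wf_digraph.\<mu> (with_proj G) (\<lambda>_. 1) x y)"

definition locally_finite_graph :: "'v pair_pre_digraph \<Rightarrow> bool" where
  "locally_finite_graph G \<longleftrightarrow> (\<forall>x\<in>pverts G. finite {y. (x, y) \<in> parcs G})"

text \<open>As in \<^const>\<open>BijGroup\<close>, automorphisms are extensional functions: outside the vertex set
  they take the value \<^const>\<open>undefined\<close>.\<close>

definition graph_Aut :: "'v pair_pre_digraph \<Rightarrow> ('v \<Rightarrow> 'v) monoid" where
  "graph_Aut G = BijGroup (pverts G)
     \<lparr>carrier := {h \<in> Bij (pverts G).
        \<forall>x\<in>pverts G. \<forall>y\<in>pverts G. (x, y) \<in> parcs G \<longleftrightarrow> (h x, h y) \<in> parcs G}\<rparr>"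

definition vertex_transitive :: "'v pair_pre_digraph \<Rightarrow> bool" where
  "vertex_transitive G \<longleftrightarrow>
     (\<forall>x\<in>pverts G. \<forall>y\<in>pverts G. \<exists>h\<in>carrier (graph_Aut G). h x = y)"

section \<open>Function spaces\<close>

text \<open>The real vector space of all functions \<open>A \<rightarrow> \<real>\<close> is rendered as the set \<open>A \<rightarrow>\<^sub>E UNIV\<close> of
  extensional functions, with operations restricted to \<open>A\<close>.\<close>

definition function_subspace :: "'v set \<Rightarrow> ('v \<Rightarrow> real) set \<Rightarrow> bool" where
  "function_subspace A S \<longleftrightarrow>
     S \<subseteq> (A \<rightarrow>\<^sub>E UNIV) \<and>
     (\<lambda>x\<in>A. 0) \<in> S \<and>
     (\<forall>f\<in>S. \<forall>g\<in>S. (\<lambda>x\<in>A. f x + g x) \<in> S) \<and>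
     (\<forall>c. \<forall>f\<in>S. (\<lambda>x\<in>A. c * f x) \<in> S)"

definition Lip0 :: "'v pair_pre_digraph \<Rightarrow> 'v \<Rightarrow> ('v \<Rightarrow> real) set" where
  "Lip0 G z = {f \<in> pverts G \<rightarrow>\<^sub>E UNIV. f z = 0 \<and>
     (\<exists>C. \<forall>x\<in>pverts G. \<forall>y\<in>pverts G. \<bar>f x - f y\<bar> \<le> C * graph_dist G x y)}"

definition Lip0_subspace :: "'v pair_pre_digraph \<Rightarrow> 'v \<Rightarrow> ('v \<Rightarrow> real) set \<Rightarrow> bool" where
  "Lip0_subspace G z X \<longleftrightarrow> function_subspace (pverts G) X \<and> X \<subseteq> Lip0 G z"

definition act :: "'v pair_pre_digraph \<Rightarrow> 'v \<Rightarrow> ('v \<Rightarrow> 'v) \<Rightarrow> ('v \<Rightarrow> real) \<Rightarrow> ('v \<Rightarrow> real)" where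
  "act G z h f = (\<lambda>x\<in>pverts G. f ((inv\<^bsub>graph_Aut G\<^esub> h) x) - f ((inv\<^bsub>graph_Aut G\<^esub> h) z))"

definition H_invariant ::
    "'v pair_pre_digraph \<Rightarrow> 'v \<Rightarrow> ('v \<Rightarrow> 'v) set \<Rightarrow> ('v \<Rightarrow> real) set \<Rightarrow> bool" where
  "H_invariant G z H X \<longleftrightarrow> (\<forall>h\<in>H. act G z h ` X = X)"

text \<open>The topology of pointwise convergence on functions \<open>V \<rightarrow> \<real>\<close> is the product topology.\<close>

definition pointwise_closed :: "'v pair_pre_digraph \<Rightarrow> 'v \<Rightarrow> ('v \<Rightarrow> real) set \<Rightarrow> bool" where
  "pointwise_closed G z X \<longleftrightarrow>
     closedin (subtopology (product_topology (\<lambda>_. euclideanreal) (pverts G)) (Lip0 G z)) X"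

section \<open>Patterns\<close>

text \<open>A pattern is represented together with its support \<open>A\<close>, as a pair \<open>(A, P)\<close>: with
  extensional functions, \<open>P\<close> alone need not determine \<open>A\<close>, since \<open>undefined :: real\<close> is an
  unspecified number.\<close>

definition pattern :: "'v pair_pre_digraph \<Rightarrow> 'v set \<Rightarrow> ('v \<Rightarrow> real) set \<Rightarrow> bool" where
  "pattern G A P \<longleftrightarrow> finite A \<and> A \<noteq> {} \<and> A \<subseteq> pverts G \<and> function_subspace A P"

definition compatible_with ::
    "'v pair_pre_digraph \<Rightarrow> 'v \<Rightarrow> ('v \<Rightarrow> 'v) set \<Rightarrow> 'v set \<Rightarrow> ('v \<Rightarrow> real) set \<Rightarrow> ('v \<Rightarrow> real) \<Rightarrow> bool"
  where "compatible_with G z H A P f \<longleftrightarrow> (\<forall>h\<in>H. restrict (act G z h f) A \<in> P)"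

end

theory Submission
  imports Defs
begin

text \<open>Both directions rest on the fact that a basic neighbourhood for pointwise convergence
  constrains only finitely many vertices.

  If \<open>X\<close> is pointwise closed, the patterns are all restrictions of \<open>X\<close> to finite non-empty sets
  \<open>A\<close>. Members of \<open>X\<close> are compatible with these because \<open>X\<close> is invariant. Conversely,
  compatibility of \<open>f\<close>, used for the identity automorphism alone, says that on every finite set
  \<open>f\<close> agrees with some member of \<open>X\<close>; so \<open>f\<close> lies in the pointwise closure of \<open>X\<close>
  (\<open>pointwise_closedD\<close>), which is \<open>X\<close>.

  If \<open>X\<close> is given by patterns, it is an intersection of closed conditions: by
  \<open>separating_functional\<close>, a subspace \<open>P\<close> of \<open>\<real>\<^sup>A\<close> with \<open>A\<close> finite is the common kernel of the
  linear functionals that vanish on it, and composing such a functional with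
  \<open>f \<mapsto> (h \<cdot> f)\<restriction>A\<close> gives a linear combination of finitely many values of \<open>f\<close>, which is
  pointwise continuous.\<close>

section \<open>Subspaces of function spaces\<close>

text \<open>Gaussian elimination, one coordinate at a time: if some member of \<open>S\<close> is non-zero at the
  new coordinate, it is used to clear that coordinate from all the other functions, and the
  coefficient there is then forced.\<close>

lemma separating_functional:
  fixes S :: "('a \<Rightarrow> real) set"
  assumes "finite A"
    and "(\<lambda>x. 0) \<in> S"
    and "\<And>s t c. s \<in> S \<Longrightarrow> t \<in> S \<Longrightarrow> (\<lambda>x. s x + c * t x) \<in> S"
    and "\<And>s. s \<in> S \<Longrightarrow> \<exists>a\<in>A. s a \<noteq> g a"
  shows "\<exists>c. (\<forall>s\<in>S. (\<Sum>a\<in>A. c a * s a) = 0) \<and> (\<Sum>a\<in>A. c a * g a) \<noteq> 0"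
  using assms
proof (induction A arbitrary: S g rule: finite_induct)
  case empty
  then show ?case by blast
next
  case (insert a A)
  note zero = insert.prems(1) and lin = insert.prems(2) and apart = insert.prems(3)
  show ?case
  proof (cases "\<forall>s\<in>S. s a = 0")
    case True
    show ?thesis
    proof (cases "g a = 0")
      case True
      have "\<exists>b\<in>A. s b \<noteq> g b" if "s \<in> S" for s
        using apart[OF that] that \<open>\<forall>s\<in>S. s a = 0\<close> True by auto
      from insert.IH[OF zero lin this]
      obtain c where "\<forall>s\<in>S. (\<Sum>b\<in>A. c b * s b) = 0" "(\<Sum>b\<in>A. c b * g b) \<noteq> 0"
        by blast
      with \<open>\<forall>s\<in>S. s a = 0\<close> True insert.hyps show ?thesis
        by (intro exI[of _ c]) simp
    next
      case False
      have "(\<Sum>b\<in>insert a A. (if b = a then 1 else 0) * f b) = f a" for f :: "'a \<Rightarrow> real"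
      proof -
        have "(\<Sum>b\<in>A. (if b = a then 1 else 0) * f b) = 0"
          by (rule sum.neutral) (use insert.hyps in auto)
        then show ?thesis using insert.hyps by simp
      qed
      with False \<open>\<forall>s\<in>S. s a = 0\<close> show ?thesis
        by (intro exI[of _ "\<lambda>b. if b = a then 1 else 0"]) simp
    qed
  next
    case False
    then obtain t where t: "t \<in> S" "t a \<noteq> 0" by blast
    define u where "u = (\<lambda>x. 0 + inverse (t a) * t x)"
    have u: "u \<in> S" "u a = 1"
      using lin[OF zero t(1), of "inverse (t a)"] t(2) by (simp_all add: u_def)
    define S' where "S' = {s \<in> S. s a = 0}"
    define g' where "g' = (\<lambda>x. g x - g a * u x)"
    have apart': "\<exists>b\<in>A. s b \<noteq> g' b" if s: "s \<in> S'" for s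
    proof -
      have "(\<lambda>x. s x + g a * u x) \<in> S"
        using lin[of s u "g a"] s u(1) by (simp add: S'_def)
      from apart[OF this] s u(2) show ?thesis
        by (force simp: S'_def g'_def)
    qed
    have zero': "(\<lambda>x. 0) \<in> S'" and lin': "\<And>s t c. s \<in> S' \<Longrightarrow> t \<in> S' \<Longrightarrow> (\<lambda>x. s x + c * t x) \<in> S'"
      using zero lin by (auto simp: S'_def)
    from insert.IH[OF zero' lin' apart']
    obtain c where c: "\<forall>s\<in>S'. (\<Sum>b\<in>A. c b * s b) = 0" "(\<Sum>b\<in>A. c b * g' b) \<noteq> 0"
      by blast
    define d where "d = c(a := - (\<Sum>b\<in>A. c b * u b))"
    \<comment> \<open>The coefficient at \<open>a\<close> is chosen so that \<open>d\<close> kills \<open>u\<close>; hence \<open>d\<close> takes the same value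
      on \<open>f\<close> as \<open>c\<close> does on \<open>f\<close> cleared at \<open>a\<close>.\<close>
    have d: "(\<Sum>b\<in>insert a A. d b * f b) = (\<Sum>b\<in>A. c b * (f b - f a * u b))" for f
    proof -
      have "(\<Sum>b\<in>A. d b * f b) = (\<Sum>b\<in>A. c b * f b)"
        by (rule sum.cong) (use insert.hyps in \<open>auto simp: d_def\<close>)
      moreover have "(\<Sum>b\<in>A. c b * (f b - f a * u b))
          = (\<Sum>b\<in>A. c b * f b) - f a * (\<Sum>b\<in>A. c b * u b)"
        by (simp add: right_diff_distrib sum_subtractf sum_distrib_left mult.left_commute)
      ultimately show ?thesis
        using insert.hyps by (simp add: d_def algebra_simps)
    qed
    have "(\<lambda>x. s x - s a * u x) \<in> S'" if "s \<in> S" for s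
      using lin[OF that u(1), of "- s a"] u(2) by (simp add: S'_def)
    with c show ?thesis
      by (intro exI[of _ d]) (auto simp: d g'_def)
  qed
qed

lemma function_subspaceD:
  assumes "function_subspace A P"
  shows "(\<lambda>x\<in>A. 0) \<in> P"
    and "\<And>f g. f \<in> P \<Longrightarrow> g \<in> P \<Longrightarrow> (\<lambda>x\<in>A. f x + g x) \<in> P"
    and "\<And>f c. f \<in> P \<Longrightarrow> (\<lambda>x\<in>A. c * f x) \<in> P"
  using assms by (simp_all add: function_subspace_def)

lemma function_subspace_restrict:
  assumes X: "function_subspace V X" and A: "A \<subseteq> V"
  shows "function_subspace A ((\<lambda>f. restrict f A) ` X)"
proof -
  have zero: "(\<lambda>x\<in>A. 0) = restrict (\<lambda>x\<in>V. 0 :: real) A"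
    and add: "(\<lambda>x\<in>A. restrict f A x + restrict g A x) = restrict (\<lambda>x\<in>V. f x + g x) A"
    and scale: "(\<lambda>x\<in>A. c * restrict f A x) = restrict (\<lambda>x\<in>V. c * f x) A"
    for f g :: "'a \<Rightarrow> real" and c
    using A by (auto simp: restrict_def fun_eq_iff)
  show ?thesis
    unfolding function_subspace_def
  proof (intro conjI ballI allI)
    show "(\<lambda>f. restrict f A) ` X \<subseteq> A \<rightarrow>\<^sub>E UNIV" by auto
    show "(\<lambda>x\<in>A. 0) \<in> (\<lambda>f. restrict f A) ` X"
      by (subst zero) (intro imageI function_subspaceD(1)[OF X])
  next
    fix p q assume "p \<in> (\<lambda>f. restrict f A) ` X" "q \<in> (\<lambda>f. restrict f A) ` X"
    then obtain f g where fg: "f \<in> X" "g \<in> X" and pq: "p = restrict f A" "q = restrict g A"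
      by blast
    show "(\<lambda>x\<in>A. p x + q x) \<in> (\<lambda>f. restrict f A) ` X"
      unfolding pq add by (intro imageI function_subspaceD(2)[OF X] fg)
  next
    fix c p assume "p \<in> (\<lambda>f. restrict f A) ` X"
    then obtain f where f: "f \<in> X" and p: "p = restrict f A" by blast
    show "(\<lambda>x\<in>A. c * p x) \<in> (\<lambda>f. restrict f A) ` X"
      unfolding p scale by (intro imageI function_subspaceD(3)[OF X] f)
  qed
qed

lemma function_subspace_separation:
  assumes A: "finite A" and P: "function_subspace A P" and g: "restrict g A \<notin> P"
  shows "\<exists>c. (\<forall>f. restrict f A \<in> P \<longrightarrow> (\<Sum>a\<in>A. c a * f a) = 0) \<and> (\<Sum>a\<in>A. c a * g a) \<noteq> 0"
proof -
  define S where "S = {f. restrict f A \<in> P}"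
  have "(\<lambda>x. s x + c * t x) \<in> S" if "s \<in> S" "t \<in> S" for s t c
  proof -
    have s: "restrict s A \<in> P" and t: "restrict t A \<in> P"
      using that by (simp_all add: S_def)
    have "(\<lambda>x\<in>A. restrict s A x + (\<lambda>y\<in>A. c * restrict t A y) x) \<in> P"
      by (rule function_subspaceD(2)[OF P s function_subspaceD(3)[OF P t]])
    moreover have "(\<lambda>x\<in>A. restrict s A x + (\<lambda>y\<in>A. c * restrict t A y) x)
        = (\<lambda>x\<in>A. s x + c * t x)"
      by (auto simp: restrict_def fun_eq_iff)
    ultimately show ?thesis by (simp add: S_def)
  qed
  moreover have "(\<lambda>x. 0) \<in> S"
    using function_subspaceD(1)[OF P] by (simp add: S_def)
  moreover have "\<exists>a\<in>A. s a \<noteq> g a" if "s \<in> S" for s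
  proof (rule ccontr)
    assume "\<not> ?thesis"
    then have "restrict s A = restrict g A" by (auto simp: restrict_def fun_eq_iff)
    with that g show False by (simp add: S_def)
  qed
  ultimately have "\<exists>c. (\<forall>s\<in>S. (\<Sum>a\<in>A. c a * s a) = 0) \<and> (\<Sum>a\<in>A. c a * g a) \<noteq> 0"
    using A by (intro separating_functional)
  then show ?thesis by (simp add: S_def)
qed

section \<open>The action of automorphisms\<close>

lemma carrier_graph_Aut_subset: "carrier (graph_Aut G) \<subseteq> Bij (pverts G)"
  unfolding graph_Aut_def by auto

lemma subgroup_inv_in_verts:
  assumes "subgroup H (graph_Aut G)" "h \<in> H" "x \<in> pverts G"
  shows "(inv\<^bsub>graph_Aut G\<^esub> h) x \<in> pverts G"
proof -
  have "inv\<^bsub>graph_Aut G\<^esub> h \<in> carrier (graph_Aut G)"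
    using subgroup.m_inv_closed[OF assms(1,2)] subgroup.subset[OF assms(1)] by (rule subsetD[rotated])
  then have "inv\<^bsub>graph_Aut G\<^esub> h \<in> Bij (pverts G)" by (rule subsetD[OF carrier_graph_Aut_subset])
  then show ?thesis using assms(3) by (rule funcset_mem[OF Bij_imp_funcset])
qed

lemma inv_one_graph_Aut: "inv\<^bsub>graph_Aut G\<^esub> \<one>\<^bsub>graph_Aut G\<^esub> = (\<lambda>x\<in>pverts G. x)"
proof -
  let ?e = "\<lambda>x\<in>pverts G. x"
  have e: "?e \<in> Bij (pverts G)" by (rule id_Bij)
  have "compose (pverts G) ?e y = y" if "y \<in> Bij (pverts G)" for y
    using that Bij_imp_funcset[OF that] Bij_imp_extensional[OF that]
    by (simp add: Id_compose)
  with e show ?thesis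
    unfolding m_inv_def graph_Aut_def BijGroup_def
    by (intro the_equality) auto
qed

lemma act_one:
  assumes "f \<in> Lip0 G z" "z \<in> pverts G"
  shows "act G z \<one>\<^bsub>graph_Aut G\<^esub> f = f"
  using assms by (auto simp: act_def inv_one_graph_Aut Lip0_def fun_eq_iff PiE_def extensional_def)

section \<open>Pointwise closedness\<close>

lemma topspace_Lip0:
  "topspace (subtopology (product_topology (\<lambda>_. euclideanreal) (pverts G)) (Lip0 G z)) = Lip0 G z"
  by (auto simp: Lip0_def)

text \<open>Agreement on finite sets suffices because a basic open set of the product topology restricts
  only finitely many coordinates. The set tested also contains \<open>z\<close>, so that it is a legitimate
  support of a pattern even when no coordinate is restricted.\<close>

lemma pointwise_closedD:
  assumes closed: "pointwise_closed G z X" and X: "X \<subseteq> Lip0 G z" and z: "z \<in> pverts G"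
    and f: "f \<in> Lip0 G z"
    and approx: "\<And>A. finite A \<Longrightarrow> A \<noteq> {} \<Longrightarrow> A \<subseteq> pverts G \<Longrightarrow> \<exists>g\<in>X. restrict g A = restrict f A"
  shows "f \<in> X"
proof -
  let ?T = "product_topology (\<lambda>_. euclideanreal) (pverts G)"
  let ?L = "subtopology ?T (Lip0 G z)"
  have "f \<in> ?L closure_of X"
    unfolding in_closure_of topspace_Lip0
  proof (intro conjI f allI impI)
    fix W assume W: "f \<in> W \<and> openin ?L W"
    then obtain U where U: "openin ?T U" "W = U \<inter> Lip0 G z"
      by (auto simp: openin_subtopology)
    have "\<forall>x\<in>U. \<exists>B. finite {i \<in> pverts G. B i \<noteq> topspace euclideanreal} \<and>
        (\<forall>i\<in>pverts G. openin euclideanreal (B i)) \<and> x \<in> Pi\<^sub>E (pverts G) B \<and> Pi\<^sub>E (pverts G) B \<subseteq> U"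
      using U(1) unfolding openin_product_topology_alt .
    moreover have "f \<in> U" using W U(2) by blast
    ultimately obtain B where B: "finite {i \<in> pverts G. B i \<noteq> UNIV}"
        "f \<in> Pi\<^sub>E (pverts G) B" "Pi\<^sub>E (pverts G) B \<subseteq> U"
      by force
    let ?A = "insert z {i \<in> pverts G. B i \<noteq> UNIV}"
    have "\<exists>g\<in>X. restrict g ?A = restrict f ?A"
      by (rule approx) (use B(1) z in auto)
    then obtain g where g: "g \<in> X" "restrict g ?A = restrict f ?A"
      by blast
    have agree: "g x = f x" if "x \<in> ?A" for x
      using fun_cong[OF g(2), of x] that by (simp only: restrict_apply if_True)
    have "g \<in> Pi\<^sub>E (pverts G) B"
    proof (rule PiE_I)
      fix x assume "x \<in> pverts G"
      then show "g x \<in> B x"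
        using agree[of x] B(2) by (cases "B x = UNIV") auto
    next
      fix x assume "x \<notin> pverts G"
      then show "g x = undefined" using g(1) X by (auto simp: Lip0_def)
    qed
    with B(3) U(2) g(1) X show "\<exists>g. g \<in> X \<and> g \<in> W" by blast
  qed
  with closed show ?thesis
    by (simp add: pointwise_closed_def closure_of_closedin)
qed

lemma continuous_map_act_combination:
  assumes H: "subgroup H (graph_Aut G)" and h: "h \<in> H" and z: "z \<in> pverts G"
    and A: "finite A" "A \<subseteq> pverts G"
  shows "continuous_map (subtopology (product_topology (\<lambda>_. euclideanreal) (pverts G)) (Lip0 G z))
    euclideanreal (\<lambda>f. \<Sum>a\<in>A. c a * act G z h f a)"
proof -
  have proj: "continuous_map (product_topology (\<lambda>_. euclideanreal) (pverts G)) euclideanreal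
      (\<lambda>f. f ((inv\<^bsub>graph_Aut G\<^esub> h) x))" if "x \<in> pverts G" for x
    using subgroup_inv_in_verts[OF H h that] by (rule continuous_map_product_projection)
  have eq: "(\<lambda>f. \<Sum>a\<in>A. c a * act G z h f a) = (\<lambda>f. \<Sum>a\<in>A. c a *
      (f ((inv\<^bsub>graph_Aut G\<^esub> h) a) - f ((inv\<^bsub>graph_Aut G\<^esub> h) z)))"
    by (rule ext, rule sum.cong) (use A in \<open>auto simp: act_def\<close>)
  show ?thesis
    unfolding eq
    by (intro continuous_map_from_subtopology continuous_map_sum continuous_map_real_mult
        continuous_map_diff proj z A(1)) (use A in auto)
qed

text \<open>An incompatible \<open>f\<close> is separated from the compatible functions by a continuous functional
  that vanishes on all of them, so it cannot be one of their limits.\<close>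

lemma pointwise_closed_compatible:
  assumes H: "subgroup H (graph_Aut G)" and z: "z \<in> pverts G"
    and patterns: "\<And>A P. (A, P) \<in> \<P> \<Longrightarrow> pattern G A P"
  shows "pointwise_closed G z {f \<in> Lip0 G z. \<forall>(A, P)\<in>\<P>. compatible_with G z H A P f}"
    (is "pointwise_closed G z ?X")
proof -
  let ?L = "subtopology (product_topology (\<lambda>_. euclideanreal) (pverts G)) (Lip0 G z)"
  have "restrict (act G z h f) A \<in> P"
    if f: "f \<in> ?L closure_of ?X" and AP: "(A, P) \<in> \<P>" and h: "h \<in> H" for f A P h
  proof (rule ccontr)
    assume nP: "restrict (act G z h f) A \<notin> P"
    have A: "finite A" "A \<subseteq> pverts G" and P: "function_subspace A P"
      using patterns[OF AP] by (auto simp: pattern_def)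
    obtain c where c: "\<And>k. restrict k A \<in> P \<Longrightarrow> (\<Sum>a\<in>A. c a * k a) = 0"
        "(\<Sum>a\<in>A. c a * act G z h f a) \<noteq> 0"
      using function_subspace_separation[OF A(1) P nP] by blast
    let ?Z = "{k \<in> topspace ?L. (\<Sum>a\<in>A. c a * act G z h k a) \<in> {0}}"
    have "closedin ?L ?Z"
      by (rule closedin_continuous_map_preimage[OF continuous_map_act_combination[OF H h z A]]) simp
    moreover have "?X \<subseteq> ?Z"
      unfolding topspace_Lip0 using AP h c(1) by (fastforce simp: compatible_with_def)
    ultimately have "f \<in> ?Z" using f closure_of_minimal by blast
    with c(2) show False by simp
  qed
  moreover have "?L closure_of ?X \<subseteq> Lip0 G z"
    using closure_of_subset_topspace[of ?L] unfolding topspace_Lip0 by blast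
  ultimately have "?L closure_of ?X \<subseteq> ?X"
    by (auto simp: compatible_with_def)
  then show ?thesis
    unfolding pointwise_closed_def closure_of_subset_eq[symmetric] topspace_Lip0 by auto
qed

section \<open>Closed invariant subspaces and patterns\<close>

theorem proposition3p2:
  fixes G :: "'v pair_pre_digraph" and z :: 'v
    and H :: "('v \<Rightarrow> 'v) set" and X :: "('v \<Rightarrow> real) set"
  assumes "pair_sym_digraph G"
    and "Digraph_Component.connected (with_proj G)"
    and "locally_finite_graph G"
    and "vertex_transitive G"
    and "infinite (pverts G)"
    and "z \<in> pverts G"
    and "subgroup H (graph_Aut G)"
    and "Lip0_subspace G z X"
    and "H_invariant G z H X"
  shows "(Lip0_subspace G z X \<and> H_invariant G z H X \<and> pointwise_closed G z X) \<longleftrightarrow>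
    (\<exists>\<P> :: ('v set \<times> ('v \<Rightarrow> real) set) set.
       (\<forall>(A, P)\<in>\<P>. pattern G A P) \<and>
       X = {f \<in> Lip0 G z. \<forall>(A, P)\<in>\<P>. compatible_with G z H A P f})"
proof
  assume "Lip0_subspace G z X \<and> H_invariant G z H X \<and> pointwise_closed G z X"
  then have closed: "pointwise_closed G z X" by simp
  have X: "function_subspace (pverts G) X" "X \<subseteq> Lip0 G z"
    using assms(8) by (auto simp: Lip0_subspace_def)
  define \<P> where "\<P> = {(A, (\<lambda>f. restrict f A) ` X) |A. finite A \<and> A \<noteq> {} \<and> A \<subseteq> pverts G}"
  have "\<forall>(A, P)\<in>\<P>. pattern G A P"
    using function_subspace_restrict[OF X(1)] by (auto simp: \<P>_def pattern_def)
  moreover have "X = {f \<in> Lip0 G z. \<forall>(A, P)\<in>\<P>. compatible_with G z H A P f}"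
  proof (intro equalityI subsetI)
    fix f assume f: "f \<in> X"
    then have "act G z h f \<in> X" if "h \<in> H" for h
      using assms(9) that by (auto simp: H_invariant_def)
    with f X(2) show "f \<in> {f \<in> Lip0 G z. \<forall>(A, P)\<in>\<P>. compatible_with G z H A P f}"
      by (auto simp: \<P>_def compatible_with_def)
  next
    fix f assume "f \<in> {f \<in> Lip0 G z. \<forall>(A, P)\<in>\<P>. compatible_with G z H A P f}"
    then have f: "f \<in> Lip0 G z" and compat: "\<And>A P. (A, P) \<in> \<P> \<Longrightarrow> compatible_with G z H A P f"
      by auto
    show "f \<in> X"
    proof (rule pointwise_closedD[OF closed X(2) assms(6) f])
      fix A assume "finite A" "A \<noteq> {}" "A \<subseteq> pverts G"
      then have "compatible_with G z H A ((\<lambda>g. restrict g A) ` X) f"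
        by (intro compat) (auto simp: \<P>_def)
      then have "restrict (act G z \<one>\<^bsub>graph_Aut G\<^esub> f) A \<in> (\<lambda>g. restrict g A) ` X"
        using subgroup.one_closed[OF assms(7)] by (auto simp: compatible_with_def)
      then show "\<exists>g\<in>X. restrict g A = restrict f A"
        unfolding act_one[OF f assms(6)] by auto
    qed
  qed
  ultimately show "\<exists>\<P>. (\<forall>(A, P)\<in>\<P>. pattern G A P) \<and>
      X = {f \<in> Lip0 G z. \<forall>(A, P)\<in>\<P>. compatible_with G z H A P f}"
    by blast
next
  assume "\<exists>\<P>. (\<forall>(A, P)\<in>\<P>. pattern G A P) \<and>
      X = {f \<in> Lip0 G z. \<forall>(A, P)\<in>\<P>. compatible_with G z H A P f}"
  then obtain \<P> where patterns: "\<forall>(A, P)\<in>\<P>. pattern G A P"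
    and X: "X = {f \<in> Lip0 G z. \<forall>(A, P)\<in>\<P>. compatible_with G z H A P f}"
    by blast
  have "pointwise_closed G z X"
    unfolding X by (rule pointwise_closed_compatible[OF assms(7,6)]) (use patterns in blast)
  with assms(8,9) show "Lip0_subspace G z X \<and> H_invariant G z H X \<and> pointwise_closed G z X"
    by blast
qed

end
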